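(* Let $d\leq d'$ be positive integers, $\xi_d=e^{2\pi i/d}$, and fix a decomposition $J_{d\times d'}=P_0+P_1+\cdots+P_{d'-1}$ of the all-ones $d\times d'$ matrix into $d\times d'$ permutation matrices. For $l\in\{0,\dots,d'-1\}$ and $a\in\{0,\dots,d-1\}$ let $Q_l^a$ be the $d\times d'$ matrix with $Q_l^a(i,j)=0$ if $P_l(i,j)=0$ and $Q_l^a(i,j)=\xi_d^{a(i-1)}$ if $P_l(i,j)=1$ (rows indexed $i=1,\dots,d$), and let $Z_0=\{Q_l^a: l\in\{1,\dots,d'-1\},\ a\in\{0,\dots,d-1\}\}$. Let $H=(h_{y,i})$ be an $m\times d$ partial Hadamard matrix with $m<d$, and for $y=1,\dots,m$ let $H_y$ be the $d\times d'$ matrix with $H_y(i,j)=0$ if $P_0(i,j)=0$ and $H_y(i,j)=h_{y,i}$ if $P_0(i,j)=1$; let $Z_1=\{H_y\}_{y=1}^m$. Then the states $\{\frac{1}{\sqrt{d}}\sum_{i,j}M(i,j)|i\rangle|j\rangle : M\in Z_0\cup Z_1\}$ form a $(d(d'-1)+m)$-number UMEB in $\mathbb{C}^{d}\otimes\mathbb{C}^{d'}$ (equivalently, $Z_0\cup Z_1$ is an unextendible $d$-singular-value-1 Hilbert–Schmidt basis of $\mathcal{M}_{d\times d'}$) if and only if $H$ cannot be extended to an $(m+1)\times d$ partial Hadamard matrix, i.e. there is no vector in $\mathbb{C}^d$ with all entries of modulus $1$ that is orthogonal to every row of $H$.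
   Context: For $p\leq q$, a $p\times q$ permutation matrix is a $0$-$1$ matrix with exactly one entry $1$ in each row and at most one entry $1$ in each column. A partial Hadamard matrix is an $m\times d$ complex matrix ($m<d$) whose entries all have modulus $1$ and whose rows are pairwise orthogonal. A maximally entangled state in $\mathbb{C}^{d}\otimes\mathbb{C}^{d'}$ ($d\leq d'$) is a pure state of Schmidt rank $d$ with all Schmidt coefficients $1/\sqrt{d}$; an $n$-number UMEB is a set of $n<dd'$ orthonormal maximally entangled states such that no maximally entangled state is orthogonal to all of them. A $d\times d'$ matrix is $d$-singular-value-1 if its nonzero singular values are exactly $d$ ones; an $n$-number unextendible $d$-singular-value-1 Hilbert–Schmidt basis of $\mathcal{M}_{d\times d'}$ is a set of $n<dd'$ such matrices $A_i$ with $\mathrm{Tr}(A_i^\dagger A_j)=d\delta_{ij}$ such that no $d$-singular-value-1 matrix $B$ satisfies $\mathrm{Tr}(A_i^\dagger B)=0$ for all $i$. *)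

theory Defs
  imports "Jordan_Normal_Form.Char_Poly" "Jordan_Normal_Form.Schur_Decomposition" Complex_Main
begin

text \<open>
  Matrices and vectors are those of \<open>Jordan_Normal_Form\<close>, indexed from 0; thus row \<open>i\<close> below is
  row \<open>i + 1\<close> in 1-based numbering. The product \<open>v \<bullet>c w\<close> is conjugate-linear in \<open>w\<close>.
\<close>

definition all_ones_mat :: "nat \<Rightarrow> nat \<Rightarrow> complex mat" where
  "all_ones_mat p q = mat p q (\<lambda>_. 1)"

definition permutation_mat :: "nat \<Rightarrow> nat \<Rightarrow> complex mat \<Rightarrow> bool" where
  "permutation_mat p q A \<longleftrightarrow>
     p \<le> q \<and> A \<in> carrier_mat p q \<and>
     (\<forall>i<p. \<forall>j<q. A $$ (i, j) \<in> {0, 1}) \<and>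
     (\<forall>i<p. \<exists>!j. j < q \<and> A $$ (i, j) = 1) \<and>
     (\<forall>j<q. \<exists>\<^sub>\<le>\<^sub>1i. i < p \<and> A $$ (i, j) = 1)"

definition perm_decomposition :: "nat \<Rightarrow> nat \<Rightarrow> (nat \<Rightarrow> complex mat) \<Rightarrow> bool" where
  "perm_decomposition d d' P \<longleftrightarrow>
     (\<forall>l<d'. permutation_mat d d' (P l)) \<and>
     all_ones_mat d d' = mat d d' (\<lambda>(i, j). \<Sum>l<d'. P l $$ (i, j))"

text \<open>Unlike \<open>partial_hadamard\<close>, this also covers the square case \<open>m = d\<close>.\<close>

definition unimodular_orthogonal_rows :: "nat \<Rightarrow> nat \<Rightarrow> complex mat \<Rightarrow> bool" where
  "unimodular_orthogonal_rows m d H \<longleftrightarrow>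
     H \<in> carrier_mat m d \<and>
     (\<forall>y<m. \<forall>i<d. cmod (H $$ (y, i)) = 1) \<and>
     (\<forall>y<m. \<forall>z<m. y \<noteq> z \<longrightarrow> row H y \<bullet>c row H z = 0)"

definition partial_hadamard :: "nat \<Rightarrow> nat \<Rightarrow> complex mat \<Rightarrow> bool" where
  "partial_hadamard m d H \<longleftrightarrow> m < d \<and> unimodular_orthogonal_rows m d H"

text \<open>
  For \<open>m + 1 = d\<close> an extension of an \<open>m \<times> d\<close> partial Hadamard matrix is a full \<open>d \<times> d\<close> Hadamard
  matrix; it counts as an extension.
\<close>

definition hadamard_extendible :: "nat \<Rightarrow> nat \<Rightarrow> complex mat \<Rightarrow> bool" where
  "hadamard_extendible m d H \<longleftrightarrow>
     (\<exists>H'. unimodular_orthogonal_rows (m + 1) d H' \<and> (\<forall>y<m. row H' y = row H y))"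

text \<open>\<open>|i\<rangle>|j\<rangle>\<close> is the standard basis vector of index \<open>i * d' + j\<close> of \<open>\<complex>\<^bsup>d * d'\<^esup>\<close>.\<close>

definition tensor_vec :: "complex vec \<Rightarrow> complex vec \<Rightarrow> complex vec" where
  "tensor_vec v w =
     vec (dim_vec v * dim_vec w) (\<lambda>k. v $ (k div dim_vec w) * w $ (k mod dim_vec w))"

definition orthonormal_family :: "nat \<Rightarrow> nat \<Rightarrow> (nat \<Rightarrow> complex vec) \<Rightarrow> bool" where
  "orthonormal_family n r e \<longleftrightarrow>
     (\<forall>k<r. e k \<in> carrier_vec n) \<and>
     (\<forall>k<r. \<forall>l<r. e k \<bullet>c e l = (if k = l then 1 else 0))"

definition pure_state :: "nat \<Rightarrow> complex vec \<Rightarrow> bool" where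
  "pure_state n \<psi> \<longleftrightarrow> \<psi> \<in> carrier_vec n \<and> \<psi> \<bullet>c \<psi> = 1"

text \<open>The number \<open>r\<close> is the Schmidt rank and the \<open>c k\<close> are the Schmidt coefficients of \<open>\<psi>\<close>.\<close>

definition schmidt_decomposition ::
  "nat \<Rightarrow> nat \<Rightarrow> complex vec \<Rightarrow> nat \<Rightarrow> (nat \<Rightarrow> real) \<Rightarrow>
   (nat \<Rightarrow> complex vec) \<Rightarrow> (nat \<Rightarrow> complex vec) \<Rightarrow> bool" where
  "schmidt_decomposition d d' \<psi> r c e f \<longleftrightarrow>
     (\<forall>k<r. c k > 0) \<and> orthonormal_family d r e \<and> orthonormal_family d' r f \<and>
     \<psi> = finsum_vec TYPE(complex) (d * d')
           (\<lambda>k. complex_of_real (c k) \<cdot>\<^sub>v tensor_vec (e k) (f k)) {..<r}"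

definition maximally_entangled :: "nat \<Rightarrow> nat \<Rightarrow> complex vec \<Rightarrow> bool" where
  "maximally_entangled d d' \<psi> \<longleftrightarrow>
     pure_state (d * d') \<psi> \<and>
     (\<exists>e f. schmidt_decomposition d d' \<psi> d (\<lambda>_. 1 / sqrt (real d)) e f)"

definition umeb :: "nat \<Rightarrow> nat \<Rightarrow> nat \<Rightarrow> complex vec set \<Rightarrow> bool" where
  "umeb d d' n S \<longleftrightarrow>
     finite S \<and> card S = n \<and> n < d * d' \<and>
     (\<forall>\<psi>\<in>S. maximally_entangled d d' \<psi>) \<and>
     (\<forall>\<psi>\<in>S. \<forall>\<phi>\<in>S. \<psi> \<bullet>c \<phi> = (if \<psi> = \<phi> then 1 else 0)) \<and>
     \<not> (\<exists>\<phi>. maximally_entangled d d' \<phi> \<and> (\<forall>\<psi>\<in>S. \<phi> \<bullet>c \<psi> = 0))"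

definition state_of_mat :: "nat \<Rightarrow> nat \<Rightarrow> complex mat \<Rightarrow> complex vec" where
  "state_of_mat d d' M =
     complex_of_real (1 / sqrt (real d)) \<cdot>\<^sub>v
     finsum_vec TYPE(complex) (d * d')
       (\<lambda>(i, j). M $$ (i, j) \<cdot>\<^sub>v tensor_vec (unit_vec d i) (unit_vec d' j)) ({..<d} \<times> {..<d'})"

definition mat_trace :: "complex mat \<Rightarrow> complex" where
  "mat_trace A = (\<Sum>i<dim_row A. A $$ (i, i))"

text \<open>
  The singular values with multiplicity: the square roots of the eigenvalues of \<open>A\<^sup>\<dagger> A\<close>, all of
  which are real and nonnegative, so that \<open>Re\<close> merely changes the type.
\<close>

definition singular_values :: "complex mat \<Rightarrow> real multiset" where
  "singular_values A =
     image_mset (\<lambda>z. sqrt (Re z)) (proots (char_poly (mat_adjoint A * A)))"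

definition singular_value_1_mat :: "nat \<Rightarrow> nat \<Rightarrow> complex mat \<Rightarrow> bool" where
  "singular_value_1_mat d d' A \<longleftrightarrow>
     A \<in> carrier_mat d d' \<and>
     filter_mset (\<lambda>s. s \<noteq> 0) (singular_values A) = replicate_mset d 1"

definition unextendible_sv1_hs_basis :: "nat \<Rightarrow> nat \<Rightarrow> nat \<Rightarrow> complex mat set \<Rightarrow> bool" where
  "unextendible_sv1_hs_basis d d' n Z \<longleftrightarrow>
     finite Z \<and> card Z = n \<and> n < d * d' \<and>
     (\<forall>A\<in>Z. singular_value_1_mat d d' A) \<and>
     (\<forall>A\<in>Z. \<forall>B\<in>Z. mat_trace (mat_adjoint A * B) = (if A = B then of_nat d else 0)) \<and>
     \<not> (\<exists>B. singular_value_1_mat d d' B \<and> (\<forall>A\<in>Z. mat_trace (mat_adjoint A * B) = 0))"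

definition xi :: "nat \<Rightarrow> complex" where
  "xi d = exp (2 * of_real pi * \<i> / of_nat d)"

definition Q_mat :: "nat \<Rightarrow> nat \<Rightarrow> (nat \<Rightarrow> complex mat) \<Rightarrow> nat \<Rightarrow> nat \<Rightarrow> complex mat" where
  "Q_mat d d' P l a = mat d d' (\<lambda>(i, j). if P l $$ (i, j) = 1 then xi d ^ (a * i) else 0)"

definition H_mat ::
  "nat \<Rightarrow> nat \<Rightarrow> (nat \<Rightarrow> complex mat) \<Rightarrow> complex mat \<Rightarrow> nat \<Rightarrow> complex mat" where
  "H_mat d d' P H y = mat d d' (\<lambda>(i, j). if P 0 $$ (i, j) = 1 then H $$ (y, i) else 0)"

definition Z0 :: "nat \<Rightarrow> nat \<Rightarrow> (nat \<Rightarrow> complex mat) \<Rightarrow> complex mat set" where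
  "Z0 d d' P = {Q_mat d d' P l a |l a. l \<in> {1..<d'} \<and> a < d}"

definition Z1 ::
  "nat \<Rightarrow> nat \<Rightarrow> (nat \<Rightarrow> complex mat) \<Rightarrow> nat \<Rightarrow> complex mat \<Rightarrow> complex mat set" where
  "Z1 d d' P m H = {H_mat d d' P H y |y. y < m}"

end

theory Submission
  imports Defs
begin

text \<open>
  A \<open>d \<times> d'\<close> matrix \<open>A\<close> is \<open>d\<close>-singular-value-1 iff \<open>A A\<^sup>\<dagger> = 1\<close>, because \<open>A\<^sup>\<dagger> A\<close> and \<open>A A\<^sup>\<dagger>\<close> have the
  same nonzero characteristic roots and a Hermitian matrix whose only characteristic root is 1 is the
  identity; and \<open>A A\<^sup>\<dagger> = 1\<close> says exactly that the associated state is maximally entangled. A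
  matrix \<open>B\<close> orthogonal to all \<open>Q\<^sub>l\<^sup>a\<close> with \<open>l \<ge> 1\<close> vanishes, by Fourier inversion, on the support of
  \<open>P\<^sub>l\<close> for every \<open>l \<ge> 1\<close>, so it lives on the support of \<open>P\<^sub>0\<close>. There \<open>B B\<^sup>\<dagger> = 1\<close> says that its entries
  have modulus 1, and orthogonality to the \<open>H\<^sub>y\<close> says that they form a vector orthogonal to the rows
  of \<open>H\<close>.
\<close>

section \<open>Adjoints and singular values\<close>

lemma dim_mat_adjoint [simp]:
  "dim_row (mat_adjoint A) = dim_col A" "dim_col (mat_adjoint A) = dim_row A"
  by (auto simp: mat_adjoint_def)

lemma mat_adjoint_carrier [simp]:
  "A \<in> carrier_mat n m \<Longrightarrow> mat_adjoint A \<in> carrier_mat m n"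
  by (intro carrier_matI) auto

lemma index_mat_adjoint [simp]:
  "i < dim_col A \<Longrightarrow> j < dim_row A \<Longrightarrow> mat_adjoint A $$ (i, j) = conjugate (A $$ (j, i))"
  by (simp add: mat_adjoint_def mat_of_rows_index)

lemma mat_adjoint_adjoint [simp]: "mat_adjoint (mat_adjoint A) = (A :: complex mat)"
  by (rule eq_matI) auto

lemma mat_adjoint_mult:
  fixes A B :: "complex mat"
  assumes "A \<in> carrier_mat n m" "B \<in> carrier_mat m k"
  shows "mat_adjoint (A * B) = mat_adjoint B * mat_adjoint A"
  using assms by (intro eq_matI) (auto simp: scalar_prod_def mult.commute intro!: sum.cong)

lemma index_mult_adjoint:
  fixes A B :: "complex mat"
  assumes "A \<in> carrier_mat n k" "B \<in> carrier_mat m k" "i < n" "j < m"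
  shows "(A * mat_adjoint B) $$ (i, j) = (\<Sum>t<k. A $$ (i, t) * cnj (B $$ (j, t)))"
  using assms by (auto simp: scalar_prod_def lessThan_atLeast0 intro!: sum.cong)

lemma mat_trace_mult:
  assumes "A \<in> carrier_mat n m" "B \<in> carrier_mat m n"
  shows "mat_trace (A * B) = (\<Sum>i<n. \<Sum>j<m. A $$ (i, j) * B $$ (j, i))"
  using assms by (auto simp: mat_trace_def scalar_prod_def lessThan_atLeast0 intro!: sum.cong)

lemma mat_trace_commute:
  assumes "A \<in> carrier_mat n m" "B \<in> carrier_mat m n"
  shows "mat_trace (A * B) = mat_trace (B * A)"
  unfolding mat_trace_mult[OF assms] mat_trace_mult[OF assms(2,1)]
  by (subst sum.swap) (simp add: mult.commute)

lemma mat_trace_adjoint_mult: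
  assumes "A \<in> carrier_mat n m" "B \<in> carrier_mat n m"
  shows "mat_trace (mat_adjoint A * B) = (\<Sum>i<n. \<Sum>j<m. cnj (A $$ (i, j)) * B $$ (i, j))"
  using assms by (subst mat_trace_mult[of _ m n], simp, simp, subst sum.swap)
    (auto intro!: sum.cong)

text \<open>The trace is the sum of the squared moduli of all entries, and a sum of nonnegative
  reals vanishes only termwise.\<close>

lemma mat_trace_adjoint_self_eq_0_iff:
  assumes "A \<in> carrier_mat n m"
  shows "mat_trace (mat_adjoint A * A) = 0 \<longleftrightarrow> A = 0\<^sub>m n m"
proof
  assume "mat_trace (mat_adjoint A * A) = 0"
  moreover have "mat_trace (mat_adjoint A * A)
      = complex_of_real (\<Sum>i<n. \<Sum>j<m. (cmod (A $$ (i, j)))\<^sup>2)"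
    unfolding mat_trace_adjoint_mult[OF assms assms] of_real_sum
    by (intro sum.cong refl) (metis complex_norm_square mult.commute)
  ultimately have "(\<Sum>i<n. \<Sum>j<m. (cmod (A $$ (i, j)))\<^sup>2) = 0"
    by (metis of_real_eq_0_iff)
  hence "\<forall>i<n. \<forall>j<m. A $$ (i, j) = 0"
    by (simp add: sum_nonneg_eq_0_iff sum_nonneg)
  thus "A = 0\<^sub>m n m"
    using assms by (intro eq_matI) auto
next
  assume "A = 0\<^sub>m n m"
  thus "mat_trace (mat_adjoint A * A) = 0"
    by (simp add: mat_trace_def)
qed

section \<open>Characteristic polynomials and the roots of Gram matrices\<close>

lemma char_poly_upper_triangular_const_diag:
  fixes A :: "complex mat"
  assumes "A \<in> carrier_mat n n" "upper_triangular A" "\<And>i. i < n \<Longrightarrow> A $$ (i, i) = c"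
  shows "char_poly A = [:- c, 1:] ^ n"
proof -
  have "diag_mat A = replicate n c"
    using assms by (intro nth_equalityI) (auto simp: diag_mat_def)
  thus ?thesis
    using assms by (simp add: char_poly_upper_triangular[of A n] prod_list_replicate)
qed

text \<open>Conjugating by the block matrix \<open>[1, A; 0, 1]\<close> turns \<open>[A B, 0; B, 0]\<close> into
  \<open>[0, 0; B, B A]\<close>.\<close>

lemma char_poly_mult_commute:
  fixes A B :: "complex mat"
  assumes A: "A \<in> carrier_mat n m" and B: "B \<in> carrier_mat m n"
  shows "char_poly (A * B) * [:0, 1:] ^ m = [:0, 1:] ^ n * char_poly (B * A)"
proof -
  let ?X = "four_block_mat (A * B) (0\<^sub>m n m) B (0\<^sub>m m m)"
  let ?Y = "four_block_mat (0\<^sub>m n n) (0\<^sub>m n m) B (B * A)"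
  let ?S = "four_block_mat (1\<^sub>m n) A (0\<^sub>m m n) (1\<^sub>m m)"
  let ?T = "four_block_mat (1\<^sub>m n) (- A) (0\<^sub>m m n) (1\<^sub>m m)"
  note block_mult = mult_four_block_mat[where ?nr1.0 = n and ?nr2.0 = m and ?n1.0 = n and ?n2.0 = m
      and ?nc1.0 = n and ?nc2.0 = m]
  have neg: "- A \<in> carrier_mat n m" "A * B \<in> carrier_mat n n" "B * A \<in> carrier_mat m m"
    using A B by auto
  have [simp]: "- 0\<^sub>m m m = (0\<^sub>m m m :: complex mat)"
    by (rule eq_matI) auto
  have [simp]: "A + - A = 0\<^sub>m n m" "- A + A = 0\<^sub>m n m"
    using A by (auto intro!: eq_matI)
  have ST: "?S * ?T = 1\<^sub>m (n + m)" "?T * ?S = 1\<^sub>m (n + m)"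
    using A B neg by (subst block_mult; simp)+
  have SY: "?S * ?Y = four_block_mat (A * B) (A * (B * A)) B (B * A)"
    using A B neg by (subst block_mult; simp)
  have [simp]: "- (A * (B * A)) + A * (B * A) = 0\<^sub>m n m" "- (B * A) + B * A = 0\<^sub>m m m"
    using A B by (auto intro!: uminus_l_inv_mat)
  have "?S * ?Y * ?T = ?X"
    unfolding SY using A B neg
    by (subst block_mult; simp)
  hence "similar_mat ?X ?Y"
    using A B ST neg unfolding similar_mat_def similar_mat_wit_def Let_def
    by (intro exI[of _ ?S] exI[of _ ?T]) auto
  hence eq: "char_poly ?X = char_poly ?Y"
    by (rule char_poly_similar)
  \<comment> \<open>The block triangular rule asks for characteristic polynomials that split into
    linear factors, which holds over the complex numbers.\<close>
  have fact: "\<exists>es. char_poly M = (\<Prod>e\<leftarrow>es. [:- e, 1:])"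
    if "M \<in> carrier_mat k k" for M :: "complex mat" and k
    using char_poly_factorized[OF that] by blast
  have "char_poly ?X = char_poly (A * B) * char_poly (0\<^sub>m m m)"
    by (rule char_poly_0_block'[OF refl fact[OF neg(2)] fact[OF zero_carrier_mat] neg(2) B zero_carrier_mat])
  moreover have "char_poly ?Y = char_poly (0\<^sub>m n n) * char_poly (B * A)"
    by (rule char_poly_0_block'[OF refl fact[OF zero_carrier_mat] fact[OF neg(3)] zero_carrier_mat B neg(3)])
  \<comment> \<open>The zero diagonal blocks supply the powers of the variable that compensate for
    the different sizes of \<open>A * B\<close> and \<open>B * A\<close>.\<close>
  moreover have "char_poly (0\<^sub>m k k) = [:0, 1 :: complex:] ^ k" for k
    using char_poly_upper_triangular_const_diag[of "0\<^sub>m k k" k 0] by simp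
  ultimately show ?thesis
    using eq by simp
qed

text \<open>For an eigenvector \<open>v\<close>, moving the adjoint across the inner product gives
  that \<open>z\<close> times the squared norm of \<open>v\<close> is the squared norm of
  \<open>A *\<^sub>v v\<close>. Hence \<open>sqrt (Re z)\<close> in \<open>singular_values\<close>
  loses no information about \<open>z\<close>.\<close>

lemma eigenvalue_adjoint_mult_self_nonneg:
  fixes A :: "complex mat"
  assumes A: "A \<in> carrier_mat n m" and z: "eigenvalue (mat_adjoint A * A) z"
  shows "Im z = 0 \<and> Re z \<ge> 0"
proof -
  obtain v where v: "v \<in> carrier_vec m" "v \<noteq> 0\<^sub>v m"
    and eq: "(mat_adjoint A * A) *\<^sub>v v = z \<cdot>\<^sub>v v"
    using z A unfolding eigenvalue_def eigenvector_def by auto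
  have "z * (v \<bullet>c v) = (z \<cdot>\<^sub>v v) \<bullet>c v"
    using v by simp
  also have "\<dots> = (mat_adjoint A *\<^sub>v (A *\<^sub>v v)) \<bullet>c v"
    using A v by (simp flip: eq add: assoc_mult_mat_vec[of _ m n _ m])
  also have "\<dots> = (\<Sum>i<m. (\<Sum>k<n. cnj (A $$ (k, i)) * (A *\<^sub>v v) $ k) * cnj (v $ i))"
    using A v by (auto simp: scalar_prod_def lessThan_atLeast0 intro!: sum.cong)
  also have "\<dots> = (\<Sum>k<n. (A *\<^sub>v v) $ k * cnj (\<Sum>i<m. A $$ (k, i) * v $ i))"
    by (simp add: sum_distrib_left sum_distrib_right, subst sum.swap) (simp add: mult_ac)
  also have "\<dots> = (A *\<^sub>v v) \<bullet>c (A *\<^sub>v v)"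
    using A v by (auto simp: scalar_prod_def lessThan_atLeast0 intro!: sum.cong)
  finally have eq: "z * (v \<bullet>c v) = (A *\<^sub>v v) \<bullet>c (A *\<^sub>v v)" .
  \<comment> \<open>In the order on complex numbers, comparable numbers have equal imaginary parts,
    so both products are real and \<open>z\<close> is a quotient of reals.\<close>
  have "v \<bullet>c v > 0" "(A *\<^sub>v v) \<bullet>c (A *\<^sub>v v) \<ge> 0"
    using v by auto
  then obtain a b :: real where ab: "v \<bullet>c v = of_real a" "a > 0"
      "(A *\<^sub>v v) \<bullet>c (A *\<^sub>v v) = of_real b" "b \<ge> 0"
    by (intro that[of "Re (v \<bullet>c v)" "Re ((A *\<^sub>v v) \<bullet>c (A *\<^sub>v v))"])
      (auto simp: less_complex_def less_eq_complex_def complex_eq_iff)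
  hence "z = of_real (b / a)"
    using eq by (simp add: field_simps)
  thus ?thesis
    using ab by simp
qed

text \<open>Schur triangularization makes \<open>G - 1\<close> similar to a strictly upper
  triangular matrix, so its square has trace 0. Since \<open>G - 1\<close> is Hermitian, this trace
  is also the sum of the squared moduli of its entries, which forces \<open>G = 1\<close>.\<close>

lemma hermitian_eq_one_if_char_roots_1:
  fixes G :: "complex mat"
  assumes G: "G \<in> carrier_mat n n" and herm: "mat_adjoint G = G"
    and roots: "\<And>z. poly (char_poly G) z = 0 \<Longrightarrow> z = 1"
  shows "G = 1\<^sub>m n"
proof -
  obtain es where es: "char_poly G = (\<Prod>e\<leftarrow>es. [:- e, 1:])" "length es = n"
    using char_poly_factorized[OF G] by blast
  have es1: "set es \<subseteq> {1}"
    using roots by (auto simp: es poly_prod_list prod_list_zero_iff image_iff o_def)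
  obtain T P Q where "schur_decomposition G es = (T, P, Q)"
    by (cases "schur_decomposition G es") auto
  from schur_decomposition[OF G es(1) this]
  have wit: "similar_mat_wit G T P Q" and ut: "upper_triangular T" and diag: "diag_mat T = es"
    by auto
  from similar_mat_witD2[OF G wit]
  have PQ: "P * Q = 1\<^sub>m n" "Q * P = 1\<^sub>m n" "G = P * T * Q"
    and carr: "T \<in> carrier_mat n n" "P \<in> carrier_mat n n" "Q \<in> carrier_mat n n"
    by auto
  define S where "S = T - 1\<^sub>m n"
  define N where "N = G - 1\<^sub>m n"
  have S: "S \<in> carrier_mat n n" and N: "N \<in> carrier_mat n n"
    using carr G by (auto simp: S_def N_def)
  have Tii: "T $$ (i, i) = 1" if "i < n" for i
  proof -
    have "T $$ (i, i) = es ! i"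
      using that carr by (simp flip: diag add: diag_mat_def)
    thus ?thesis using that es es1 nth_mem by fastforce
  qed
  have S0: "S $$ (i, j) = 0" if "i < n" "j \<le> i" for i j
    using that carr Tii upper_triangularD[OF ut, of j i] by (cases "i = j") (auto simp: S_def)
  have N_eq: "N = P * S * Q"
    using carr PQ by (simp add: S_def N_def mult_minus_distrib_mat[of _ n n _ n]
        minus_mult_distrib_mat[of _ n n _ _ n])
  have "N * N = P * (S * S) * Q"
  proof -
    have "N * N = P * S * (Q * P) * S * Q"
      using carr S unfolding N_eq by (simp add: assoc_mult_mat[of _ n n _ n _ n])
    thus ?thesis
      using carr S PQ by (simp add: assoc_mult_mat[of _ n n _ n _ n])
  qed
  \<comment> \<open>Cyclicity of the trace brings \<open>P\<close> next to \<open>Q\<close>, where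
    they cancel.\<close>
  hence "mat_trace (N * N) = mat_trace (P * (S * S * Q))"
    using carr S by (simp add: assoc_mult_mat[of _ n n _ n _ n])
  also have "\<dots> = mat_trace (S * S * Q * P)"
    using carr S by (intro mat_trace_commute[of _ n n]) auto
  also have "S * S * Q * P = S * S"
    using carr S PQ by (simp add: assoc_mult_mat[of _ n n _ n _ n])
  also have "mat_trace (S * S) = (\<Sum>i<n. \<Sum>j<n. S $$ (i, j) * S $$ (j, i))"
    by (rule mat_trace_mult[OF S S])
  also have "\<dots> = 0"
  proof (intro sum.neutral ballI)
    fix i j assume "i \<in> {..<n}" "j \<in> {..<n}"
    \<comment> \<open>One of the positions \<open>(i, j)\<close> and \<open>(j, i)\<close> lies on
      or below the diagonal, where \<open>S\<close> is 0.\<close>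
    thus "S $$ (i, j) * S $$ (j, i) = 0"
      using S0[of i j] S0[of j i] by (cases "j \<le> i") auto
  qed
  finally have "mat_trace (N * N) = 0" .
  moreover have "mat_adjoint N = N"
  proof (rule eq_matI)
    fix i j assume "i < dim_row N" "j < dim_col N"
    thus "mat_adjoint N $$ (i, j) = N $$ (i, j)"
      using G N arg_cong[OF herm, of "\<lambda>A. A $$ (i, j)"] by (auto simp: N_def)
  qed (use N in auto)
  ultimately have N0: "N = 0\<^sub>m n n"
    using mat_trace_adjoint_self_eq_0_iff[OF N] by simp
  have "G = N + 1\<^sub>m n"
    using G by (auto simp: N_def intro!: eq_matI)
  thus ?thesis
    using N0 by simp
qed

text \<open>Taking root multisets in \<open>char_poly_mult_commute\<close>, the powers of the
  variable contribute only the root 0, so the two Gram matrices agree on nonzero roots. This moves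
  the question from size \<open>m\<close> to size \<open>n\<close>.\<close>

lemma nonzero_singular_values:
  assumes A: "A \<in> carrier_mat n m"
  shows "filter_mset (\<lambda>s. s \<noteq> 0) (singular_values A) =
    image_mset (\<lambda>z. sqrt (Re z)) (filter_mset (\<lambda>z. z \<noteq> 0) (proots (char_poly (A * mat_adjoint A))))"
proof -
  let ?B = "mat_adjoint A * A" and ?G = "A * mat_adjoint A"
  have carr: "?B \<in> carrier_mat m m" "?G \<in> carrier_mat n n"
    using A by auto
  have nz: "char_poly ?B \<noteq> 0" "char_poly ?G \<noteq> 0"
    using degree_monic_char_poly[OF carr(1)] degree_monic_char_poly[OF carr(2)] by auto
  have x0: "[:0, 1:] ^ k \<noteq> (0 :: complex poly)" for k
    by simp
  have "proots (char_poly ?G) + proots ([:0, 1:] ^ m) = proots ([:0, 1:] ^ n) + proots (char_poly ?B)"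
    using arg_cong[OF char_poly_mult_commute[OF A mat_adjoint_carrier[OF A]], of proots]
    by (simp only: proots_mult[OF nz(2) x0] proots_mult[OF x0 nz(1)])
  hence "filter_mset (\<lambda>z. z \<noteq> 0) (proots (char_poly ?G) + proots ([:0, 1:] ^ m)) =
      filter_mset (\<lambda>z. z \<noteq> 0) (proots ([:0, 1:] ^ n) + proots (char_poly ?B))"
    by simp
  moreover have "filter_mset (\<lambda>z. z \<noteq> 0) (proots ([:0, 1 :: complex:] ^ k)) = {#}" for k
    by (simp add: proots_power)
  ultimately have eq: "filter_mset (\<lambda>z. z \<noteq> 0) (proots (char_poly ?G)) =
      filter_mset (\<lambda>z. z \<noteq> 0) (proots (char_poly ?B))"
    by simp
  \<comment> \<open>Filtering before or after taking square roots agrees because the roots are real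
    and nonnegative.\<close>
  have "sqrt (Re z) \<noteq> 0 \<longleftrightarrow> z \<noteq> 0" if "z \<in># proots (char_poly ?B)" for z
  proof -
    have "eigenvalue ?B z"
      using that nz eigenvalue_root_char_poly[OF carr(1)] by simp
    thus ?thesis
      using eigenvalue_adjoint_mult_self_nonneg[OF A] by (auto simp: complex_eq_iff)
  qed
  hence "filter_mset (\<lambda>z. sqrt (Re z) \<noteq> 0) (proots (char_poly ?B)) =
      filter_mset (\<lambda>z. z \<noteq> 0) (proots (char_poly ?B))"
    by (intro filter_mset_cong) auto
  thus ?thesis
    unfolding singular_values_def eq by (simp add: filter_mset_image_mset)
qed

text \<open>The \<open>d\<close> by \<open>d\<close> Gram matrix of the rows has exactly
  \<open>d\<close> characteristic roots with multiplicity, so \<open>d\<close> nonzero singular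
  values equal to 1 account for all of them.\<close>

lemma singular_value_1_mat_iff:
  "singular_value_1_mat d d' A \<longleftrightarrow> A \<in> carrier_mat d d' \<and> A * mat_adjoint A = 1\<^sub>m d"
proof (cases "A \<in> carrier_mat d d'")
  case A: True
  let ?G = "A * mat_adjoint A"
  have G: "?G \<in> carrier_mat d d"
    using A by auto
  have nz: "char_poly ?G \<noteq> 0" and deg: "degree (char_poly ?G) = d"
    using degree_monic_char_poly[OF G] by auto
  have "image_mset (\<lambda>z. sqrt (Re z)) (filter_mset (\<lambda>z. z \<noteq> 0) (proots (char_poly ?G)))
      = replicate_mset d 1 \<longleftrightarrow> ?G = 1\<^sub>m d" (is "image_mset ?f ?F = _ \<longleftrightarrow> _")
  proof
    assume eq: "image_mset ?f ?F = replicate_mset d 1"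
    \<comment> \<open>As many roots survive the filter as the degree \<open>d\<close> allows, so
      none of them is 0.\<close>
    have "size ?F = size (proots (char_poly ?G))"
      using arg_cong[OF eq, of size] by (simp add: size_proots_complex deg)
    hence F: "?F = proots (char_poly ?G)"
      using mset_subset_size[of ?F "proots (char_poly ?G)"] multiset_filter_subset
      by (auto simp: subset_mset.less_le)
    show "?G = 1\<^sub>m d"
    proof (rule hermitian_eq_one_if_char_roots_1[OF G])
      show "mat_adjoint ?G = ?G"
        using A by (simp add: mat_adjoint_mult[of _ d d' _ d])
      fix z assume z: "poly (char_poly ?G) z = 0"
      hence "z \<in># ?F"
        using F nz by simp
      hence "?f z \<in># image_mset ?f ?F"
        by auto
      hence "Re z = 1"
        unfolding eq by (auto split: if_splits)
      \<comment> \<open>The singular values only fix \<open>Re z\<close>; reading \<open>?G\<close>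
        as the Gram matrix belonging to \<open>mat_adjoint A\<close> yields
        \<open>Im z = 0\<close>.\<close>
      moreover have "eigenvalue (mat_adjoint (mat_adjoint A) * mat_adjoint A) z"
        using z eigenvalue_root_char_poly[OF G] by simp
      hence "Im z = 0"
        using eigenvalue_adjoint_mult_self_nonneg[of "mat_adjoint A" d' d] A by simp
      ultimately show "z = 1"
        by (simp add: complex_eq_iff)
    qed
  next
    assume G1: "?G = 1\<^sub>m d"
    have "char_poly (1\<^sub>m d :: complex mat) = [:- 1, 1:] ^ d"
      by (rule char_poly_upper_triangular_const_diag) auto
    hence "proots (char_poly ?G) = repeat_mset d {#1#}"
      by (simp add: G1 proots_power)
    also have "image_mset ?f (filter_mset (\<lambda>z. z \<noteq> 0) \<dots>) = replicate_mset d 1"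
      by (induction d) auto
    finally show "image_mset ?f ?F = replicate_mset d 1" .
  qed
  thus ?thesis
    using A by (simp add: singular_value_1_mat_def nonzero_singular_values)
qed (simp add: singular_value_1_mat_def)

section \<open>Maximally entangled states\<close>

lemma cscalar_prod_sum:
  fixes v w :: "complex vec"
  assumes "w \<in> carrier_vec n"
  shows "v \<bullet>c w = (\<Sum>i<n. v $ i * cnj (w $ i))"
  using assms by (auto simp: scalar_prod_def lessThan_atLeast0 intro!: sum.cong)

text \<open>Cutting the range into \<open>n\<close> consecutive blocks of length \<open>m\<close>
  turns sums over the flat tensor index into sums over matrix positions.\<close>

lemma sum_div_mod:
  fixes f :: "nat \<Rightarrow> nat \<Rightarrow> 'a :: comm_monoid_add"
  shows "(\<Sum>k<n * m. f (k div m) (k mod m)) = (\<Sum>i<n. \<Sum>j<m. f i j)"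
proof -
  have "(\<Sum>k<n * m. f (k div m) (k mod m)) = (\<Sum>i<n. \<Sum>k = i * m..<i * m + m. f (k div m) (k mod m))"
    by (rule sum.nat_group[symmetric])
  also have "\<dots> = (\<Sum>i<n. \<Sum>j<m. f i j)"
  proof (rule sum.cong[OF refl])
    fix i
    have "(\<Sum>k = i * m..<i * m + m. f (k div m) (k mod m))
        = (\<Sum>j = 0..<m. f ((j + i * m) div m) ((j + i * m) mod m))"
      using sum.shift_bounds_nat_ivl[of "\<lambda>k. f (k div m) (k mod m)" 0 "i * m" m]
      by (simp add: add.commute)
    thus "(\<Sum>k = i * m..<i * m + m. f (k div m) (k mod m)) = (\<Sum>j<m. f i j)"
      by (simp add: lessThan_atLeast0)
  qed
  finally show ?thesis .
qed

lemma div_less_if_less_mult: "k < d * d' \<Longrightarrow> k div d' < (d :: nat)"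
  by (simp add: less_mult_imp_div_less)

lemma mod_less_if_less_mult: "k < d * d' \<Longrightarrow> k mod d' < (d' :: nat)"
  by (cases "d' = 0") auto

lemma dim_tensor_vec [simp]: "dim_vec (tensor_vec v w) = dim_vec v * dim_vec w"
  by (simp add: tensor_vec_def)

lemma tensor_vec_carrier [simp]:
  "v \<in> carrier_vec n \<Longrightarrow> w \<in> carrier_vec m \<Longrightarrow> tensor_vec v w \<in> carrier_vec (n * m)"
  by (auto simp: tensor_vec_def)

lemma index_tensor_vec:
  "v \<in> carrier_vec n \<Longrightarrow> w \<in> carrier_vec m \<Longrightarrow> k < n * m \<Longrightarrow>
    tensor_vec v w $ k = v $ (k div m) * w $ (k mod m)"
  by (auto simp: tensor_vec_def)

section \<open>States as flattened matrices\<close>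

lemma state_of_mat_carrier [simp]: "state_of_mat d d' M \<in> carrier_vec (d * d')"
  unfolding state_of_mat_def by (intro smult_carrier_vec[THEN iffD2] finsum_vec_closed) auto

lemma dim_state_of_mat [simp]: "dim_vec (state_of_mat d d' M) = d * d'"
  by (rule carrier_vecD) simp

text \<open>At index \<open>k\<close> only the basis tensor of position
  \<open>(k div d', k mod d')\<close> is nonzero, so the state is the rescaled row-by-row flattening
  of \<open>M\<close>.\<close>

lemma index_state_of_mat:
  assumes k: "k < d * d'"
  shows "state_of_mat d d' M $ k = complex_of_real (1 / sqrt d) * M $$ (k div d', k mod d')"
proof -
  let ?g = "\<lambda>(i, j). M $$ (i, j) \<cdot>\<^sub>v tensor_vec (unit_vec d i) (unit_vec d' j)"
  let ?I = "{..<d} \<times> {..<d'}"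
  have closed: "?g \<in> ?I \<rightarrow> carrier_vec (d * d')"
    by auto
  have "finsum_vec TYPE(complex) (d * d') ?g ?I $ k = (\<Sum>p\<in>?I. ?g p $ k)"
    using k closed by (intro index_finsum_vec) auto
  also have "\<dots> = (\<Sum>p\<in>?I. if p = (k div d', k mod d') then M $$ p else 0)"
  proof (rule sum.cong[OF refl])
    fix p assume "p \<in> ?I"
    then obtain i j where p: "p = (i, j)" "i < d" "j < d'"
      by auto
    have "?g p $ k = M $$ (i, j) * (unit_vec d i $ (k div d') * unit_vec d' j $ (k mod d'))"
      using k p by (simp add: index_tensor_vec[of _ d _ d'])
    thus "?g p $ k = (if p = (k div d', k mod d') then M $$ p else 0)"
      using p div_less_if_less_mult[OF k] mod_less_if_less_mult[OF k] by auto
  qed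
  also have "\<dots> = M $$ (k div d', k mod d')"
    using div_less_if_less_mult[OF k] mod_less_if_less_mult[OF k] by (simp add: sum.delta)
  finally show ?thesis
    using k carrier_vecD[OF finsum_vec_closed[OF closed]] by (simp add: state_of_mat_def)
qed

lemma index_state_of_mat_pair:
  assumes "i < d" "j < d'"
  shows "i * d' + j < d * d'"
    and "state_of_mat d d' M $ (i * d' + j) = complex_of_real (1 / sqrt d) * M $$ (i, j)"
proof -
  have "i * d' + j < Suc i * d'"
    using assms by simp
  also have "\<dots> \<le> d * d'"
    using assms by (intro mult_right_mono) auto
  finally show "i * d' + j < d * d'" .
  thus "state_of_mat d d' M $ (i * d' + j) = complex_of_real (1 / sqrt d) * M $$ (i, j)"
    using assms by (simp add: index_state_of_mat)
qed

lemma inj_on_state_of_mat: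
  assumes "0 < d"
  shows "inj_on (state_of_mat d d') (carrier_mat d d')"
proof (rule inj_onI)
  fix A B :: "complex mat"
  assume A: "A \<in> carrier_mat d d'" and B: "B \<in> carrier_mat d d'"
    and eq: "state_of_mat d d' A = state_of_mat d d' B"
  show "A = B"
  proof (rule eq_matI)
    fix i j assume "i < dim_row B" "j < dim_col B"
    hence "i < d" "j < d'"
      using B by auto
    from index_state_of_mat_pair(2)[OF this, of A] index_state_of_mat_pair(2)[OF this, of B]
    show "A $$ (i, j) = B $$ (i, j)"
      using eq assms by simp
  qed (use A B in auto)
qed

lemma state_of_mat_surj:
  assumes "0 < d" "\<psi> \<in> carrier_vec (d * d')"
  obtains A where "A \<in> carrier_mat d d'" "\<psi> = state_of_mat d d' A"
proof
  \<comment> \<open>The factor \<open>sqrt d\<close> undoes the normalization in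
    \<open>state_of_mat\<close>.\<close>
  let ?A = "mat d d' (\<lambda>(i, j). complex_of_real (sqrt d) * \<psi> $ (i * d' + j))"
  show "?A \<in> carrier_mat d d'"
    by simp
  show "\<psi> = state_of_mat d d' ?A"
  proof (rule eq_vecI)
    fix k assume "k < dim_vec (state_of_mat d d' ?A)"
    hence k: "k < d * d'"
      by simp
    have "k div d' * d' + k mod d' = k"
      by (rule div_mult_mod_eq)
    moreover have "complex_of_real (sqrt d) \<noteq> 0"
      using assms by simp
    ultimately show "\<psi> $ k = state_of_mat d d' ?A $ k"
      using div_less_if_less_mult[OF k] mod_less_if_less_mult[OF k]
      by (simp add: index_state_of_mat[OF k])
  qed (use assms in auto)
qed

text \<open>The two normalizing factors multiply to \<open>1 / d\<close>. The order of
  \<open>A\<close> and \<open>B\<close> is reversed because \<open>\<bullet>c\<close> is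
  conjugate-linear on the right and the trace form on the left.\<close>

lemma cscalar_prod_state_of_mat:
  assumes "A \<in> carrier_mat d d'" "B \<in> carrier_mat d d'"
  shows "state_of_mat d d' A \<bullet>c state_of_mat d d' B = mat_trace (mat_adjoint B * A) / of_nat d"
proof -
  let ?c = "complex_of_real (1 / sqrt d)"
  have c: "?c * ?c = 1 / of_nat d"
    by (simp flip: of_real_mult)
  have "state_of_mat d d' A \<bullet>c state_of_mat d d' B =
      (\<Sum>k<d * d'. (?c * A $$ (k div d', k mod d')) * cnj (?c * B $$ (k div d', k mod d')))"
    unfolding cscalar_prod_sum[OF state_of_mat_carrier]
    by (intro sum.cong refl) (simp add: index_state_of_mat)
  also have "\<dots> = (\<Sum>i<d. \<Sum>j<d'. (?c * A $$ (i, j)) * cnj (?c * B $$ (i, j)))"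
    by (rule sum_div_mod)
  also have "\<dots> = (\<Sum>i<d. \<Sum>j<d'. (?c * ?c) * (cnj (B $$ (i, j)) * A $$ (i, j)))"
    by (intro sum.cong refl) (simp add: mult_ac)
  also have "\<dots> = (?c * ?c) * mat_trace (mat_adjoint B * A)"
    unfolding mat_trace_adjoint_mult[OF assms(2,1)] sum_distrib_left ..
  finally show ?thesis
    unfolding c by simp
qed

text \<open>A Schmidt decomposition with equal coefficients is a factorization
  \<open>A = E * F\<close>, where \<open>E\<close> is unitary and \<open>F\<close> has orthonormal
  rows. Conversely, if the rows of \<open>A\<close> are orthonormal, they serve as the second
  family, with the standard basis as the first.\<close>

lemma maximally_entangled_state_of_mat_iff:
  assumes d: "0 < d" and A: "A \<in> carrier_mat d d'"
  shows "maximally_entangled d d' (state_of_mat d d' A) \<longleftrightarrow> A * mat_adjoint A = 1\<^sub>m d"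
proof
  assume "maximally_entangled d d' (state_of_mat d d' A)"
  then obtain e f where e: "orthonormal_family d d e" and f: "orthonormal_family d' d f"
    and eq: "state_of_mat d d' A = finsum_vec TYPE(complex) (d * d')
      (\<lambda>k. complex_of_real (1 / sqrt d) \<cdot>\<^sub>v tensor_vec (e k) (f k)) {..<d}"
    unfolding maximally_entangled_def schmidt_decomposition_def by auto
  have e_carr: "e t \<in> carrier_vec d" and f_carr: "f t \<in> carrier_vec d'" if "t < d" for t
    using e f that by (auto simp: orthonormal_family_def)
  define E where "E = mat d d (\<lambda>(i, t). e t $ i)"
  define F where "F = mat d d' (\<lambda>(t, j). f t $ j)"
  have E: "E \<in> carrier_mat d d" and F: "F \<in> carrier_mat d d'"
    by (auto simp: E_def F_def)
  have "A = E * F"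
  proof (rule eq_matI)
    fix i j assume "i < dim_row (E * F)" "j < dim_col (E * F)"
    hence ij: "i < d" "j < d'"
      using E F by auto
    note k = index_state_of_mat_pair[OF ij]
    have "complex_of_real (1 / sqrt d) * A $$ (i, j) = state_of_mat d d' A $ (i * d' + j)"
      using k by simp
    also have "\<dots> = (\<Sum>t<d. (complex_of_real (1 / sqrt d) \<cdot>\<^sub>v tensor_vec (e t) (f t)) $ (i * d' + j))"
      unfolding eq using k(1) e_carr f_carr by (intro index_finsum_vec) auto
    also have "\<dots> = (\<Sum>t<d. complex_of_real (1 / sqrt d) * (e t $ i * f t $ j))"
    proof (intro sum.cong refl)
      fix t assume "t \<in> {..<d}"
      hence "e t \<in> carrier_vec d" "f t \<in> carrier_vec d'"
        using e_carr f_carr by auto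
      thus "(complex_of_real (1 / sqrt d) \<cdot>\<^sub>v tensor_vec (e t) (f t)) $ (i * d' + j) =
          complex_of_real (1 / sqrt d) * (e t $ i * f t $ j)"
        using ij k(1) by (simp add: index_tensor_vec[of _ d _ d'])
    qed
    also have "\<dots> = complex_of_real (1 / sqrt d) * (E * F) $$ (i, j)"
      using ij unfolding sum_distrib_left[symmetric]
      by (auto simp: E_def F_def scalar_prod_def lessThan_atLeast0)
    finally show "A $$ (i, j) = (E * F) $$ (i, j)"
      using d by simp
  qed (use A E F in auto)
  have "F * mat_adjoint F = 1\<^sub>m d"
  proof (rule eq_matI)
    fix s t assume "s < dim_row (1\<^sub>m d :: complex mat)" "t < dim_col (1\<^sub>m d :: complex mat)"
    hence st: "s < d" "t < d" by auto
    have "(F * mat_adjoint F) $$ (s, t) = f s \<bullet>c f t"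
      using st by (simp add: index_mult_adjoint[OF F F] cscalar_prod_sum[OF f_carr])
        (simp add: F_def)
    thus "(F * mat_adjoint F) $$ (s, t) = 1\<^sub>m d $$ (s, t)"
      using f st by (simp add: orthonormal_family_def)
  qed (use F in auto)
  moreover have "mat_adjoint E * E = 1\<^sub>m d"
  proof (rule eq_matI)
    fix s t assume "s < dim_row (1\<^sub>m d :: complex mat)" "t < dim_col (1\<^sub>m d :: complex mat)"
    hence st: "s < d" "t < d" by auto
    have "(mat_adjoint E * E) $$ (s, t) = e t \<bullet>c e s"
      unfolding cscalar_prod_sum[OF e_carr[OF st(1)]] using st E
      by (simp add: scalar_prod_def lessThan_atLeast0) (simp add: E_def mult.commute)
    thus "(mat_adjoint E * E) $$ (s, t) = 1\<^sub>m d $$ (s, t)"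
      using e st by (auto simp: orthonormal_family_def)
  qed (use E in auto)
  \<comment> \<open>Orthonormality of the columns passes to the rows because \<open>E\<close> is
    square.\<close>
  hence "E * mat_adjoint E = 1\<^sub>m d"
    by (rule mat_mult_left_right_inverse[rotated 2]) (use E in auto)
  moreover have "A * mat_adjoint A = E * (F * mat_adjoint F) * mat_adjoint E"
  proof -
    have FE: "mat_adjoint F * mat_adjoint E \<in> carrier_mat d' d"
      using E F by auto
    show ?thesis
      unfolding \<open>A = E * F\<close> mat_adjoint_mult[OF E F] assoc_mult_mat[OF E F FE]
      using E F by (simp add: assoc_mult_mat[of _ d d' _ d _ d] assoc_mult_mat[of _ d d _ d _ d])
  qed
  ultimately show "A * mat_adjoint A = 1\<^sub>m d"
    using E by simp
next
  assume AA: "A * mat_adjoint A = 1\<^sub>m d"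
  \<comment> \<open>The common trace \<open>d\<close> cancels the factor \<open>1 / d\<close> in the
    squared norm of the state.\<close>
  have "mat_trace (mat_adjoint A * A) = mat_trace (1\<^sub>m d)"
    using A by (subst mat_trace_commute[of _ d' d]) (auto simp: AA)
  hence "pure_state (d * d') (state_of_mat d d' A)"
    using d by (simp add: pure_state_def cscalar_prod_state_of_mat[OF A A] mat_trace_def)
  moreover have "orthonormal_family d d (unit_vec d)"
    unfolding orthonormal_family_def
  proof (intro conjI allI impI)
    fix s t assume st: "s < d" "t < d"
    have "unit_vec d s \<bullet>c unit_vec d t = (\<Sum>i<d. if i = t then if s = t then 1 else 0 else (0 :: complex))"
      unfolding cscalar_prod_sum[OF unit_vec_carrier] using st by (intro sum.cong) auto
    thus "unit_vec d s \<bullet>c unit_vec d t = (if s = t then 1 else 0 :: complex)"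
      using st by simp
  qed simp
  moreover have "orthonormal_family d' d (row A)"
    unfolding orthonormal_family_def
  proof (intro conjI allI impI)
    fix s t assume st: "s < d" "t < d"
    have rt: "row A t \<in> carrier_vec d'"
      using A by auto
    have "row A s \<bullet>c row A t = (A * mat_adjoint A) $$ (s, t)"
      unfolding index_mult_adjoint[OF A A st] cscalar_prod_sum[OF rt] using A st by simp
    thus "row A s \<bullet>c row A t = (if s = t then 1 else 0)"
      using st by (simp add: AA)
  qed (use A in auto)
  moreover have "state_of_mat d d' A = finsum_vec TYPE(complex) (d * d')
      (\<lambda>k. complex_of_real (1 / sqrt d) \<cdot>\<^sub>v tensor_vec (unit_vec d k) (row A k)) {..<d}"
    (is "_ = finsum_vec _ _ ?g _")
  proof -
    have rt: "row A t \<in> carrier_vec d'" for t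
      using A by auto
    have closed: "?g \<in> {..<d} \<rightarrow> carrier_vec (d * d')"
      using rt by auto
    show ?thesis
    proof (rule eq_vecI)
      fix k assume "k < dim_vec (finsum_vec TYPE(complex) (d * d') ?g {..<d})"
      hence k: "k < d * d'"
        using carrier_vecD[OF finsum_vec_closed[OF closed]] by simp
      have "finsum_vec TYPE(complex) (d * d') ?g {..<d} $ k = (\<Sum>t<d. ?g t $ k)"
        using k closed by (intro index_finsum_vec) auto
      also have "\<dots> = (\<Sum>t<d. if t = k div d' then complex_of_real (1 / sqrt d) * A $$ (t, k mod d') else 0)"
        using k A
          div_less_if_less_mult[OF k] mod_less_if_less_mult[OF k]
        by (intro sum.cong refl) (auto simp: index_tensor_vec[OF unit_vec_carrier rt])
      also have "\<dots> = state_of_mat d d' A $ k"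
        using div_less_if_less_mult[OF k] by (simp add: index_state_of_mat[OF k])
      finally show "state_of_mat d d' A $ k = finsum_vec TYPE(complex) (d * d') ?g {..<d} $ k" ..
    qed (use carrier_vecD[OF finsum_vec_closed[OF closed]] in simp)
  qed
  ultimately show "maximally_entangled d d' (state_of_mat d d' A)"
    unfolding maximally_entangled_def schmidt_decomposition_def using d by auto
qed

text \<open>\<open>state_of_mat\<close> is a bijection from matrices to vectors that scales the
  trace form by \<open>1 / d\<close> and matches the two notions of admissible element, so the
  defining clauses correspond one by one.\<close>

lemma umeb_state_of_mat_iff:
  assumes d: "0 < d" and Z: "Z \<subseteq> carrier_mat d d'"
  shows "umeb d d' n (state_of_mat d d' ` Z) \<longleftrightarrow> unextendible_sv1_hs_basis d d' n Z"
proof -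
  let ?s = "state_of_mat d d'"
  have inj: "inj_on ?s Z"
    using inj_on_state_of_mat[OF d] Z by (rule inj_on_subset)
  have fin: "finite (?s ` Z) \<longleftrightarrow> finite Z"
    using inj by (rule finite_image_iff)
  have crd: "card (?s ` Z) = card Z"
    using inj by (rule card_image)
  have ent: "maximally_entangled d d' (?s A) \<longleftrightarrow> singular_value_1_mat d d' A"
    if "A \<in> carrier_mat d d'" for A
    using that d by (simp add: maximally_entangled_state_of_mat_iff singular_value_1_mat_iff)
  have orth: "?s B \<bullet>c ?s A = (if ?s B = ?s A then 1 else 0) \<longleftrightarrow>
      mat_trace (mat_adjoint A * B) = (if A = B then of_nat d else 0)"
    if "A \<in> Z" "B \<in> Z" for A B
    using that Z d inj_onD[OF inj, of A B]
    by (auto simp: cscalar_prod_state_of_mat subset_iff field_simps)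
  have zero: "?s B \<bullet>c ?s A = 0 \<longleftrightarrow> mat_trace (mat_adjoint A * B) = 0"
    if "A \<in> Z" "B \<in> carrier_mat d d'" for A B
    using that Z d by (simp add: cscalar_prod_state_of_mat subset_iff)
  have ext: "(\<exists>\<phi>. maximally_entangled d d' \<phi> \<and> (\<forall>\<psi>\<in>?s ` Z. \<phi> \<bullet>c \<psi> = 0)) \<longleftrightarrow>
      (\<exists>B. singular_value_1_mat d d' B \<and> (\<forall>A\<in>Z. mat_trace (mat_adjoint A * B) = 0))"
  proof
    assume "\<exists>\<phi>. maximally_entangled d d' \<phi> \<and> (\<forall>\<psi>\<in>?s ` Z. \<phi> \<bullet>c \<psi> = 0)"
    then obtain \<phi> where \<phi>: "maximally_entangled d d' \<phi>" "\<forall>\<psi>\<in>?s ` Z. \<phi> \<bullet>c \<psi> = 0"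
      by blast
    \<comment> \<open>Surjectivity enters here: a competing state is an arbitrary vector and must
      first be written as a matrix.\<close>
    then obtain B where "B \<in> carrier_mat d d'" "\<phi> = ?s B"
      using state_of_mat_surj[OF d] by (metis maximally_entangled_def pure_state_def)
    thus "\<exists>B. singular_value_1_mat d d' B \<and> (\<forall>A\<in>Z. mat_trace (mat_adjoint A * B) = 0)"
      using \<phi> ent zero by auto
  next
    assume "\<exists>B. singular_value_1_mat d d' B \<and> (\<forall>A\<in>Z. mat_trace (mat_adjoint A * B) = 0)"
    then obtain B where B: "singular_value_1_mat d d' B" "\<forall>A\<in>Z. mat_trace (mat_adjoint A * B) = 0"
      by blast
    moreover have "B \<in> carrier_mat d d'"
      using B by (simp add: singular_value_1_mat_def)
    ultimately show "\<exists>\<phi>. maximally_entangled d d' \<phi> \<and> (\<forall>\<psi>\<in>?s ` Z. \<phi> \<bullet>c \<psi> = 0)"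
      using ent zero by (intro exI[of _ "?s B"]) auto
  qed
  have "(\<forall>\<psi>\<in>?s ` Z. maximally_entangled d d' \<psi>) \<longleftrightarrow> (\<forall>A\<in>Z. singular_value_1_mat d d' A)"
    using ent Z by auto
  moreover have "(\<forall>\<psi>\<in>?s ` Z. \<forall>\<phi>\<in>?s ` Z. \<psi> \<bullet>c \<phi> = (if \<psi> = \<phi> then 1 else 0)) \<longleftrightarrow>
      (\<forall>A\<in>Z. \<forall>B\<in>Z. mat_trace (mat_adjoint A * B) = (if A = B then of_nat d else 0))"
    using orth by (simp only: ball_simps) metis
  ultimately show ?thesis
    unfolding umeb_def unextendible_sv1_hs_basis_def fin crd ext by simp
qed

section \<open>Roots of unity\<close>

lemma mult_cnj_eq_1: "cmod z = 1 \<Longrightarrow> z * cnj z = 1"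
  by (simp flip: complex_norm_square)

lemma xi_power: "xi d ^ k = cis (2 * pi * real k / real d)"
proof -
  have "xi d = cis (2 * pi / real d)"
    by (simp add: xi_def cis_conv_exp mult_ac)
  thus ?thesis
    by (simp add: DeMoivre mult_ac)
qed

lemma norm_xi_power [simp]: "cmod (xi d ^ k) = 1"
  by (simp add: xi_power)

lemma xi_power_eq_iff:
  assumes "a < d" "b < d"
  shows "xi d ^ a = xi d ^ b \<longleftrightarrow> a = b"
proof -
  have "inj_on (\<lambda>k. xi d ^ k) {..<d}"
    using bij_betw_roots_unity[of d] assms by (simp add: bij_betw_def xi_power)
  thus ?thesis
    using assms by (auto dest: inj_onD)
qed

text \<open>This is a geometric sum whose ratio \<open>w\<close> is a \<open>d\<close>-th root of
  unity, equal to 1 only if \<open>a = b\<close>.\<close>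

lemma sum_xi_orthogonal:
  assumes a: "a < d" and b: "b < d"
  shows "(\<Sum>i<d. cnj (xi d ^ (a * i)) * xi d ^ (b * i)) = (if a = b then of_nat d else 0)"
proof -
  define w where "w = cnj (xi d ^ a) * xi d ^ b"
  have sum: "(\<Sum>i<d. cnj (xi d ^ (a * i)) * xi d ^ (b * i)) = (\<Sum>i<d. w ^ i)"
    by (simp add: w_def power_mult power_mult_distrib)
  have unit: "xi d ^ a * cnj (xi d ^ a) = 1"
    by (rule mult_cnj_eq_1) simp
  have "xi d ^ d = 1"
    using a by (simp add: xi_power)
  hence "w ^ d = 1"
    by (simp add: w_def power_mult_distrib power_mult[symmetric] mult.commute[of _ d] power_mult[of _ d]
      flip: complex_cnj_power)
  moreover have "w = 1 \<longleftrightarrow> a = b"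
  proof
    assume "w = 1"
    hence "xi d ^ a * w = xi d ^ a"
      by simp
    moreover have "xi d ^ a * w = xi d ^ b"
      using unit by (simp add: w_def mult.assoc[symmetric] del: complex_cnj_power)
    ultimately show "a = b"
      using xi_power_eq_iff[OF a b] by simp
  next
    assume "a = b"
    thus "w = 1"
      using unit by (simp add: w_def mult.commute del: complex_cnj_power)
  qed
  ultimately show ?thesis
    unfolding sum by (auto simp: geometric_sum)
qed

text \<open>The hypothesis says that all Fourier coefficients of \<open>b\<close> vanish; the
  inversion formula recovers \<open>b k\<close> from them.\<close>

lemma discrete_fourier_eq_0:
  assumes zero: "\<And>a. a < d \<Longrightarrow> (\<Sum>i<d. cnj (xi d ^ (a * i)) * b i) = 0" and k: "k < d"
  shows "b k = 0"
proof -
  have "0 = (\<Sum>a<d. xi d ^ (a * k) * (\<Sum>i<d. cnj (xi d ^ (a * i)) * b i))"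
    using zero by simp
  \<comment> \<open>As \<open>a * i\<close> is symmetric, the orthogonality relation also applies
    with frequency and position exchanged.\<close>
  also have "\<dots> = (\<Sum>i<d. b i * (\<Sum>a<d. cnj (xi d ^ (i * a)) * xi d ^ (k * a)))"
    unfolding sum_distrib_left by (subst sum.swap) (simp add: mult_ac)
  also have "\<dots> = (\<Sum>i<d. if i = k then b i * of_nat d else 0)"
    using k by (intro sum.cong refl) (auto simp: sum_xi_orthogonal simp del: complex_cnj_power)
  also have "\<dots> = b k * of_nat d"
    using k by simp
  finally show ?thesis
    using k by simp
qed

section \<open>Decompositions into permutation matrices\<close>

text \<open>\<open>\<sigma> l i\<close> is the column of the entry 1 in row \<open>i\<close> of \<open>P\<^sub>l\<close>.\<close>

locale latin_rectangle =
  fixes d d' :: nat and \<sigma> :: "nat \<Rightarrow> nat \<Rightarrow> nat"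
  assumes column_less: "l < d' \<Longrightarrow> i < d \<Longrightarrow> \<sigma> l i < d'"
    and inj_row: "l < d' \<Longrightarrow> inj_on (\<sigma> l) {..<d}"
    and inj_symbol: "i < d \<Longrightarrow> inj_on (\<lambda>l. \<sigma> l i) {..<d'}"
begin

text \<open>Common form of all the matrices in question: \<open>Q_mat\<close> on layer
  \<open>l\<close> has powers of \<open>xi d\<close> as \<open>u\<close>, and \<open>H_mat\<close>
  lives on layer 0 with a row of \<open>H\<close> as \<open>u\<close>.\<close>

definition layer_mat :: "nat \<Rightarrow> (nat \<Rightarrow> complex) \<Rightarrow> complex mat" where
  "layer_mat l u = mat d d' (\<lambda>(i, j). if j = \<sigma> l i then u i else 0)"

lemma layer_mat_carrier [simp]: "layer_mat l u \<in> carrier_mat d d'"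
  by (simp add: layer_mat_def)

text \<open>Within a row, different layers occupy different columns by \<open>inj_symbol\<close>, so
  their supports are disjoint.\<close>

lemma index_layer_mat:
  "l < d' \<Longrightarrow> l' < d' \<Longrightarrow> i < d \<Longrightarrow> layer_mat l u $$ (i, \<sigma> l' i) = (if l' = l then u i else 0)"
  using column_less[of l' i] inj_onD[OF inj_symbol[of i], of l' l] by (auto simp: layer_mat_def)

text \<open>An injective self-map of a finite set is onto, so the layers cover every
  position.\<close>

lemma obtain_layer:
  assumes "i < d" "j < d'"
  obtains l where "l < d'" "j = \<sigma> l i"
proof -
  have "(\<lambda>l. \<sigma> l i) ` {..<d'} = {..<d'}"
    using assms column_less by (intro endo_inj_surj inj_symbol) auto
  thus ?thesis
    using that assms by blast
qed

lemma mat_trace_adjoint_layer_mat: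
  assumes "l < d'" "B \<in> carrier_mat d d'"
  shows "mat_trace (mat_adjoint (layer_mat l u) * B) = (\<Sum>i<d. cnj (u i) * B $$ (i, \<sigma> l i))"
proof -
  have "(\<Sum>j<d'. cnj (layer_mat l u $$ (i, j)) * B $$ (i, j)) = cnj (u i) * B $$ (i, \<sigma> l i)"
    if "i < d" for i
  proof -
    have "(\<Sum>j<d'. cnj (layer_mat l u $$ (i, j)) * B $$ (i, j))
        = (\<Sum>j<d'. if j = \<sigma> l i then cnj (u i) * B $$ (i, j) else 0)"
      using that by (intro sum.cong) (auto simp: layer_mat_def)
    thus ?thesis
      using column_less[OF assms(1) that] by simp
  qed
  thus ?thesis
    by (simp add: mat_trace_adjoint_mult[OF layer_mat_carrier assms(2)])
qed

lemma mat_trace_adjoint_layer_mat_layer_mat: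
  assumes "l < d'" "l' < d'"
  shows "mat_trace (mat_adjoint (layer_mat l u) * layer_mat l' w) =
    (if l = l' then \<Sum>i<d. cnj (u i) * w i else 0)"
  using assms by (simp add: mat_trace_adjoint_layer_mat index_layer_mat)

text \<open>Each row has a single nonzero entry; by \<open>inj_row\<close> these lie in different
  columns, so distinct rows are orthogonal.\<close>

lemma layer_mat_mult_adjoint_self:
  assumes l: "l < d'" and u: "\<And>i. i < d \<Longrightarrow> cmod (u i) = 1"
  shows "layer_mat l u * mat_adjoint (layer_mat l u) = 1\<^sub>m d"
proof (rule eq_matI)
  fix i k assume "i < dim_row (1\<^sub>m d :: complex mat)" "k < dim_col (1\<^sub>m d :: complex mat)"
  hence ik: "i < d" "k < d" by auto
  have "(layer_mat l u * mat_adjoint (layer_mat l u)) $$ (i, k)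
      = (\<Sum>j<d'. if j = \<sigma> l i then u i * (if \<sigma> l i = \<sigma> l k then cnj (u k) else 0) else 0)"
    unfolding index_mult_adjoint[OF layer_mat_carrier layer_mat_carrier ik]
    using ik by (intro sum.cong) (auto simp: layer_mat_def)
  also have "\<dots> = u i * (if i = k then cnj (u k) else 0)"
    using column_less[OF l ik(1)] inj_onD[OF inj_row[OF l], of i k] ik by auto
  finally show "(layer_mat l u * mat_adjoint (layer_mat l u)) $$ (i, k) = 1\<^sub>m d $$ (i, k)"
    using ik u by (auto simp: mult_cnj_eq_1)
qed (auto simp: layer_mat_def)

lemma eq_layer_mat_0_if_orthogonal:
  assumes B: "B \<in> carrier_mat d d'"
    and orth: "\<And>l a. l \<in> {1..<d'} \<Longrightarrow> a < d \<Longrightarrow>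
      mat_trace (mat_adjoint (layer_mat l (\<lambda>i. xi d ^ (a * i))) * B) = 0"
  shows "B = layer_mat 0 (\<lambda>i. B $$ (i, \<sigma> 0 i))"
proof (rule eq_matI)
  fix i j
  assume "i < dim_row (layer_mat 0 (\<lambda>i. B $$ (i, \<sigma> 0 i)))"
    and "j < dim_col (layer_mat 0 (\<lambda>i. B $$ (i, \<sigma> 0 i)))"
  hence ij: "i < d" "j < d'"
    by (auto simp: layer_mat_def)
  then obtain l where l: "l < d'" "j = \<sigma> l i"
    by (rule obtain_layer)
  \<comment> \<open>For fixed \<open>l\<close>, the conditions for all \<open>a < d\<close> are the
    vanishing of the Fourier coefficients of the entries of \<open>B\<close> along layer
    \<open>l\<close>.\<close>
  have "B $$ (i, \<sigma> l i) = 0" if "l \<noteq> 0"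
  proof (rule discrete_fourier_eq_0[where b = "\<lambda>i. B $$ (i, \<sigma> l i)"])
    fix a assume "a < d"
    thus "(\<Sum>i<d. cnj (xi d ^ (a * i)) * B $$ (i, \<sigma> l i)) = 0"
      using orth[of l a] l that B by (simp add: mat_trace_adjoint_layer_mat del: complex_cnj_power)
  qed (rule ij)
  thus "B $$ (i, j) = layer_mat 0 (\<lambda>i. B $$ (i, \<sigma> 0 i)) $$ (i, j)"
    using l ij index_layer_mat[of 0 l i] by (cases "l = 0") auto
qed (use B in \<open>auto simp: layer_mat_def\<close>)

end

text \<open>The unique 1 in each row defines \<open>\<sigma>\<close>, the column condition makes
  \<open>\<sigma> l\<close> injective, and the sum being the all-ones matrix makes the layers
  disjoint.\<close>

lemma latin_rectangle_of_perm_decomposition: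
  assumes P: "perm_decomposition d d' P"
  obtains \<sigma> where "latin_rectangle d d' \<sigma>"
    and "\<And>l i j. l < d' \<Longrightarrow> i < d \<Longrightarrow> j < d' \<Longrightarrow> P l $$ (i, j) = 1 \<longleftrightarrow> j = \<sigma> l i"
proof -
  define \<sigma> where "\<sigma> l i = (THE j. j < d' \<and> P l $$ (i, j) = 1)" for l i
  have perm: "permutation_mat d d' (P l)" if "l < d'" for l
    using P that by (simp add: perm_decomposition_def)
  have ex1: "\<exists>!j. j < d' \<and> P l $$ (i, j) = 1" if "l < d'" "i < d" for l i
    using perm[OF that(1)] that by (simp add: permutation_mat_def)
  have \<sigma>: "\<sigma> l i < d'" "P l $$ (i, \<sigma> l i) = 1" if "l < d'" "i < d" for l i
    using theI'[OF ex1[OF that]] by (auto simp: \<sigma>_def)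
  have iff: "P l $$ (i, j) = 1 \<longleftrightarrow> j = \<sigma> l i" if "l < d'" "i < d" "j < d'" for l i j
    using ex1[OF that(1,2)] \<sigma>[OF that(1,2)] that by auto
  have "latin_rectangle d d' \<sigma>"
  proof
    fix l assume l: "l < d'"
    show "inj_on (\<sigma> l) {..<d}"
    proof (rule inj_onI)
      fix i k assume *: "i \<in> {..<d}" "k \<in> {..<d}" "\<sigma> l i = \<sigma> l k"
      hence "\<exists>\<^sub>\<le>\<^sub>1t. t < d \<and> P l $$ (t, \<sigma> l i) = 1"
        using perm[OF l] \<sigma>[OF l] by (simp add: permutation_mat_def)
      thus "i = k"
        by (rule Uniq_D) (use * \<sigma>(2)[OF l, of i] \<sigma>(2)[OF l, of k] in auto)
    qed
  next
    fix i assume i: "i < d"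
    show "inj_on (\<lambda>l. \<sigma> l i) {..<d'}"
    proof (rule inj_onI)
      fix l l' assume *: "l \<in> {..<d'}" "l' \<in> {..<d'}" "\<sigma> l i = \<sigma> l' i"
      define j where "j = \<sigma> l i"
      have j: "j < d'"
        using * \<sigma>(1) i by (simp add: j_def)
      \<comment> \<open>Entries are 0 or 1, so the sum over the layers counts those with a 1 at
        \<open>(i, j)\<close>; it equals 1, hence \<open>l\<close> and \<open>l'\<close>
        coincide.\<close>
      have entry: "P t $$ (i, j) = (if P t $$ (i, j) = 1 then 1 else 0)" if "t < d'" for t
        using perm[OF that] i j by (auto simp: permutation_mat_def)
      have "1 = all_ones_mat d d' $$ (i, j)"
        using i j by (simp add: all_ones_mat_def)
      also have "\<dots> = (\<Sum>t<d'. P t $$ (i, j))"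
        using P i j by (simp add: perm_decomposition_def)
      also have "\<dots> = (\<Sum>t<d'. if P t $$ (i, j) = 1 then 1 else 0)"
        using entry by (intro sum.cong) auto
      also have "\<dots> = of_nat (card {t \<in> {..<d'}. P t $$ (i, j) = 1})"
        by (simp add: sum.If_cases Int_def)
      finally have "card {t \<in> {..<d'}. P t $$ (i, j) = 1} = 1"
        by (metis of_nat_1 of_nat_eq_iff)
      moreover have "l \<in> {t \<in> {..<d'}. P t $$ (i, j) = 1}" "l' \<in> {t \<in> {..<d'}. P t $$ (i, j) = 1}"
        using * \<sigma>(2)[of l i] \<sigma>(2)[of l' i] i by (auto simp: j_def)
      ultimately show "l = l'"
        by (metis card_1_singletonE singletonD)
    qed
  qed (rule \<sigma>(1))
  thus ?thesis
    using iff by (rule that)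
qed

section \<open>Extending a partial Hadamard matrix by one row\<close>

lemma hadamard_extendible_iff:
  assumes H: "unimodular_orthogonal_rows m d H"
  shows "hadamard_extendible m d H \<longleftrightarrow>
    (\<exists>v \<in> carrier_vec d. (\<forall>i<d. cmod (v $ i) = 1) \<and> (\<forall>y<m. v \<bullet>c row H y = 0))"
proof
  assume "hadamard_extendible m d H"
  then obtain H' where H': "unimodular_orthogonal_rows (m + 1) d H'" "\<forall>y<m. row H' y = row H y"
    by (auto simp: hadamard_extendible_def)
  hence carr: "H' \<in> carrier_mat (m + 1) d"
    by (simp add: unimodular_orthogonal_rows_def)
  have "row H' m \<bullet>c row H y = 0" if "y < m" for y
    using H' that unfolding unimodular_orthogonal_rows_def
    by (metis less_add_one less_irrefl trans_less_add1)
  moreover have "row H' m \<in> carrier_vec d" "\<forall>i<d. cmod (row H' m $ i) = 1"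
    using H' carr by (auto simp: unimodular_orthogonal_rows_def)
  ultimately show "\<exists>v \<in> carrier_vec d. (\<forall>i<d. cmod (v $ i) = 1) \<and> (\<forall>y<m. v \<bullet>c row H y = 0)"
    by blast
next
  assume "\<exists>v \<in> carrier_vec d. (\<forall>i<d. cmod (v $ i) = 1) \<and> (\<forall>y<m. v \<bullet>c row H y = 0)"
  then obtain v where v: "v \<in> carrier_vec d" "\<forall>i<d. cmod (v $ i) = 1" "\<forall>y<m. v \<bullet>c row H y = 0"
    by blast
  have carr: "H \<in> carrier_mat m d"
    using H by (simp add: unimodular_orthogonal_rows_def)
  \<comment> \<open>Orthogonality is required for both orders of a pair of rows, hence the conjugate
    equation.\<close>
  have v': "row H y \<bullet>c v = 0" if "y < m" for y
  proof -
    have r: "row H y \<in> carrier_vec d"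
      using carr by auto
    have "row H y \<bullet>c v = cnj (v \<bullet>c row H y)"
      by (simp add: cscalar_prod_sum[OF v(1)] cscalar_prod_sum[OF r] mult.commute)
    thus ?thesis
      using v(3) that by simp
  qed
  define H' where "H' = mat (m + 1) d (\<lambda>(y, i). if y < m then H $$ (y, i) else v $ i)"
  have row_H': "row H' y = row H y" if "y < m" for y
    using that carr by (intro eq_vecI) (auto simp: H'_def)
  have row_m: "row H' m = v"
    using v by (intro eq_vecI) (auto simp: H'_def)
  have "unimodular_orthogonal_rows (m + 1) d H'"
    unfolding unimodular_orthogonal_rows_def
  proof (intro conjI allI impI)
    fix y z assume "y < m + 1" "z < m + 1" "y \<noteq> z"
    then consider "y < m" "z < m" | "y = m" "z < m" | "y < m" "z = m"
      by linarith
    thus "row H' y \<bullet>c row H' z = 0"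
      using v(3) v' H \<open>y \<noteq> z\<close>
      by cases (simp_all add: row_H' row_m unimodular_orthogonal_rows_def)
  qed (use H v in \<open>auto simp: H'_def unimodular_orthogonal_rows_def\<close>)
  thus "hadamard_extendible m d H"
    using row_H' by (auto simp: hadamard_extendible_def)
qed

section \<open>The basis built from the layers\<close>

lemma (in latin_rectangle) unextendible_layer_basis_iff:
  assumes d': "0 < d'" and H: "partial_hadamard m d H"
  defines "Z \<equiv> {layer_mat l (\<lambda>i. xi d ^ (a * i)) |l a. l \<in> {1..<d'} \<and> a < d} \<union>
    {layer_mat 0 (\<lambda>i. H $$ (y, i)) |y. y < m}"
  shows "unextendible_sv1_hs_basis d d' (d * (d' - 1) + m) Z \<longleftrightarrow>
    \<not> (\<exists>v \<in> carrier_vec d. (\<forall>i<d. cmod (v $ i) = 1) \<and> (\<forall>y<m. v \<bullet>c row H y = 0))"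
proof -
  have m: "m < d" and H_carr: "H \<in> carrier_mat m d"
    and H_norm: "\<And>y i. y < m \<Longrightarrow> i < d \<Longrightarrow> cmod (H $$ (y, i)) = 1"
    and H_orth: "\<And>y z. y < m \<Longrightarrow> z < m \<Longrightarrow> y \<noteq> z \<Longrightarrow> row H y \<bullet>c row H z = 0"
    using H by (auto simp: partial_hadamard_def unimodular_orthogonal_rows_def)
  have row_carr: "row H y \<in> carrier_vec d" for y
    using H_carr by auto
  have row_prod: "v \<bullet>c row H y = (\<Sum>i<d. cnj (H $$ (y, i)) * v $ i)" if "y < m" for v y
    using that H_carr by (simp add: cscalar_prod_sum[OF row_carr] mult.commute)
  \<comment> \<open>One indexing for both kinds of matrices: \<open>a\<close> is a frequency on the
    layers \<open>l > 0\<close> and a row index of \<open>H\<close> on layer 0.\<close>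
  define u where "u l a i = (if l = 0 then H $$ (a, i) else xi d ^ (a * i))" for l a i :: nat
  define I where "I = {1..<d'} \<times> {..<d} \<union> {0} \<times> {..<m}"
  define g where "g = (\<lambda>(l, a). layer_mat l (u l a))"
  have u_0: "u 0 a = (\<lambda>i. H $$ (a, i))" and u_pos: "l \<noteq> 0 \<Longrightarrow> u l a = (\<lambda>i. xi d ^ (a * i))" for l a
    by (auto simp: u_def)
  have Z_eq: "Z = g ` I"
  proof -
    have "g ` I = (\<lambda>(l, a). layer_mat l (\<lambda>i. xi d ^ (a * i))) ` ({1..<d'} \<times> {..<d}) \<union>
        (\<lambda>y. layer_mat 0 (\<lambda>i. H $$ (y, i))) ` {..<m}"
      unfolding I_def image_Un by (intro arg_cong2[where f = "(\<union>)"]) (force simp: g_def u_0 u_pos)+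
    moreover have "{layer_mat l (\<lambda>i. xi d ^ (a * i)) |l a. l \<in> {1..<d'} \<and> a < d} =
        (\<lambda>(l, a). layer_mat l (\<lambda>i. xi d ^ (a * i))) ` ({1..<d'} \<times> {..<d})"
      by (force simp: image_iff)
    ultimately show ?thesis
      unfolding Z_def by auto
  qed
  have u_norm: "cmod (u l a i) = 1" if "(l, a) \<in> I" "i < d" for l a i
    using that H_norm by (auto simp: u_def I_def)
  have u_orth: "(\<Sum>i<d. cnj (u l a i) * u l b i) = (if a = b then of_nat d else 0)"
    if "(l, a) \<in> I" "(l, b) \<in> I" for l a b
  proof (cases "a = b")
    case True
    have "cnj (u l a i) * u l a i = 1" if "i < d" for i
      using u_norm[OF \<open>(l, a) \<in> I\<close> that] by (simp add: mult.commute[of "cnj _"] mult_cnj_eq_1)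
    thus ?thesis
      using True by simp
  next
    case False
    show ?thesis
    proof (cases "l = 0")
      case True
      hence ab: "a < m" "b < m"
        using that by (auto simp: I_def)
      have "row H b \<bullet>c row H a = (\<Sum>i<d. cnj (H $$ (a, i)) * H $$ (b, i))"
        using ab H_carr by (simp add: row_prod)
      thus ?thesis
        using H_orth[of b a] ab False True by (simp add: u_0)
    next
      case nz: False
      thus ?thesis
        using that sum_xi_orthogonal[of a d b] by (simp add: u_pos I_def)
    qed
  qed
  have less: "l < d'" if "(l, a) \<in> I" for l a
    using that d' by (auto simp: I_def)
  \<comment> \<open>Different layers are orthogonal by disjointness of supports, equal layers by
    \<open>u_orth\<close>.\<close>
  have gram: "mat_trace (mat_adjoint (g p) * g q) = (if p = q then of_nat d else 0)"
    if "p \<in> I" "q \<in> I" for p q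
    using that less u_orth
    by (cases p; cases q) (auto simp: g_def mat_trace_adjoint_layer_mat_layer_mat)
  have inj: "inj_on g I"
  proof (rule inj_onI)
    fix p q assume "p \<in> I" "q \<in> I" "g p = g q"
    \<comment> \<open>For distinct \<open>p\<close> and \<open>q\<close> the same trace would be
      both 0 and \<open>d\<close>, while \<open>m < d\<close> makes \<open>d\<close>
      nonzero.\<close>
    thus "p = q"
      using gram[of p q] gram[of p p] m by (auto split: if_splits)
  qed
  have fin: "finite Z"
    by (simp add: Z_eq I_def)
  have "card Z = card I"
    unfolding Z_eq using inj by (rule card_image)
  also have "\<dots> = card ({1..<d'} \<times> {..<d}) + card ({0 :: nat} \<times> {..<m})"
    unfolding I_def by (rule card_Un_disjoint) auto
  also have "\<dots> = d * (d' - 1) + m"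
    by (simp add: mult.commute)
  finally have crd: "card Z = d * (d' - 1) + m" .
  have bound: "d * (d' - 1) + m < d * d'"
    using m d' by (cases d') auto
  have sv: "\<forall>A\<in>Z. singular_value_1_mat d d' A"
    unfolding Z_eq g_def using less u_norm
    by (auto simp: singular_value_1_mat_iff intro!: layer_mat_mult_adjoint_self)
  have orth: "\<forall>A\<in>Z. \<forall>B\<in>Z. mat_trace (mat_adjoint A * B) = (if A = B then of_nat d else 0)"
    unfolding Z_eq using gram inj_onD[OF inj] by (smt (verit) imageE)
  have "(\<exists>B. singular_value_1_mat d d' B \<and> (\<forall>A\<in>Z. mat_trace (mat_adjoint A * B) = 0)) \<longleftrightarrow>
      (\<exists>v \<in> carrier_vec d. (\<forall>i<d. cmod (v $ i) = 1) \<and> (\<forall>y<m. v \<bullet>c row H y = 0))"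
  proof
    assume "\<exists>B. singular_value_1_mat d d' B \<and> (\<forall>A\<in>Z. mat_trace (mat_adjoint A * B) = 0)"
    then obtain B where B: "B \<in> carrier_mat d d'" and BB: "B * mat_adjoint B = 1\<^sub>m d"
      and B_orth: "\<And>A. A \<in> Z \<Longrightarrow> mat_trace (mat_adjoint A * B) = 0"
      by (auto simp: singular_value_1_mat_iff)
    define v where "v = vec d (\<lambda>i. B $$ (i, \<sigma> 0 i))"
    have "B = layer_mat 0 (\<lambda>i. B $$ (i, \<sigma> 0 i))"
      using B by (rule eq_layer_mat_0_if_orthogonal) (rule B_orth, unfold Z_def, blast)
    also have "\<dots> = layer_mat 0 (\<lambda>i. v $ i)"
      by (auto simp: layer_mat_def v_def intro!: eq_matI)
    finally have B_eq: "B = layer_mat 0 (\<lambda>i. v $ i)" .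
    have "cmod (v $ i) = 1" if "i < d" for i
    proof -
      \<comment> \<open>A diagonal entry of \<open>B * mat_adjoint B\<close>: row \<open>i\<close>
        of \<open>B\<close> has only the entry \<open>v $ i\<close>, so its squared modulus must be
        1.\<close>
      have "1 = (\<Sum>j<d'. B $$ (i, j) * cnj (B $$ (i, j)))"
        using that arg_cong[OF BB, of "\<lambda>M. M $$ (i, i)"] index_mult_adjoint[OF B B that that] by simp
      also have "\<dots> = (\<Sum>j<d'. if j = \<sigma> 0 i then v $ i * cnj (v $ i) else 0)"
        using that by (intro sum.cong) (auto simp: B_eq layer_mat_def)
      also have "\<dots> = v $ i * cnj (v $ i)"
        using column_less[OF d' that] by simp
      also have "\<dots> = complex_of_real ((cmod (v $ i))\<^sup>2)"
        by (rule complex_norm_square[symmetric])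
      finally have "(cmod (v $ i))\<^sup>2 = 1"
        by (metis of_real_eq_1_iff)
      thus ?thesis
        by (simp add: power2_eq_1_iff) (smt (verit) norm_ge_zero)
    qed
    moreover have "v \<bullet>c row H y = 0" if "y < m" for y
    proof -
      have "mat_trace (mat_adjoint (layer_mat 0 (\<lambda>i. H $$ (y, i))) * B) = 0"
        using that by (intro B_orth) (auto simp: Z_def)
      thus ?thesis
        using that d' by (simp add: row_prod B_eq mat_trace_adjoint_layer_mat_layer_mat)
    qed
    moreover have "v \<in> carrier_vec d"
      by (simp add: v_def)
    ultimately show "\<exists>v \<in> carrier_vec d. (\<forall>i<d. cmod (v $ i) = 1) \<and> (\<forall>y<m. v \<bullet>c row H y = 0)"
      by blast
  next
    assume "\<exists>v \<in> carrier_vec d. (\<forall>i<d. cmod (v $ i) = 1) \<and> (\<forall>y<m. v \<bullet>c row H y = 0)"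
    then obtain v where v: "\<forall>i<d. cmod (v $ i) = 1" "\<forall>y<m. v \<bullet>c row H y = 0"
      by blast
    \<comment> \<open>Placing \<open>v\<close> on layer 0 gives the extending matrix: disjoint
      supports make it orthogonal to the other layers, and the choice of \<open>v\<close> to the
      matrices from \<open>H\<close>.\<close>
    have "singular_value_1_mat d d' (layer_mat 0 (\<lambda>i. v $ i))"
      using v d' by (simp add: singular_value_1_mat_iff layer_mat_mult_adjoint_self)
    moreover have "\<forall>A\<in>Z. mat_trace (mat_adjoint A * layer_mat 0 (\<lambda>i. v $ i)) = 0"
      using v d' by (auto simp: Z_def mat_trace_adjoint_layer_mat_layer_mat row_prod)
    ultimately show "\<exists>B. singular_value_1_mat d d' B \<and> (\<forall>A\<in>Z. mat_trace (mat_adjoint A * B) = 0)"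
      by blast
  qed
  thus ?thesis
    unfolding unextendible_sv1_hs_basis_def using fin crd bound sv orth by simp
qed

theorem theorem5p1:
  fixes d d' m :: nat and P :: "nat \<Rightarrow> complex mat" and H :: "complex mat"
  assumes "0 < d" and "d \<le> d'"
    and "perm_decomposition d d' P"
    and "partial_hadamard m d H"
  shows "(umeb d d' (d * (d' - 1) + m) (state_of_mat d d' ` (Z0 d d' P \<union> Z1 d d' P m H))
            \<longleftrightarrow> \<not> hadamard_extendible m d H) \<and>
         (umeb d d' (d * (d' - 1) + m) (state_of_mat d d' ` (Z0 d d' P \<union> Z1 d d' P m H))
            \<longleftrightarrow> unextendible_sv1_hs_basis d d' (d * (d' - 1) + m) (Z0 d d' P \<union> Z1 d d' P m H)) \<and>
         (\<not> hadamard_extendible m d H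
            \<longleftrightarrow> \<not> (\<exists>v \<in> carrier_vec d. (\<forall>i<d. cmod (v $ i) = 1) \<and> (\<forall>y<m. v \<bullet>c row H y = 0)))"
proof -
  obtain \<sigma> where "latin_rectangle d d' \<sigma>"
    and \<sigma>: "\<And>l i j. l < d' \<Longrightarrow> i < d \<Longrightarrow> j < d' \<Longrightarrow> P l $$ (i, j) = 1 \<longleftrightarrow> j = \<sigma> l i"
    using latin_rectangle_of_perm_decomposition[OF assms(3)] by blast
  then interpret latin_rectangle d d' \<sigma>
    by simp
  have d': "0 < d'"
    using assms by simp
  \<comment> \<open>The map \<open>\<sigma>\<close> describes \<open>P l\<close> only for
    \<open>l < d'\<close>, which covers all layers occurring in \<open>Z0\<close>.\<close>
  have Q: "Q_mat d d' P l a = layer_mat l (\<lambda>i. xi d ^ (a * i))" if "l < d'" for l a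
    using that \<sigma> by (auto simp: Q_mat_def layer_mat_def intro!: eq_matI)
  have H: "H_mat d d' P H y = layer_mat 0 (\<lambda>i. H $$ (y, i))" for y
    using d' \<sigma> by (auto simp: H_mat_def layer_mat_def intro!: eq_matI)
  have "Z0 d d' P = {layer_mat l (\<lambda>i. xi d ^ (a * i)) |l a. l \<in> {1..<d'} \<and> a < d}"
    unfolding Z0_def using Q by (metis (no_types, lifting) atLeastLessThan_iff)
  moreover have "Z1 d d' P m H = {layer_mat 0 (\<lambda>i. H $$ (y, i)) |y. y < m}"
    by (simp add: Z1_def H)
  moreover have "Z0 d d' P \<union> Z1 d d' P m H \<subseteq> carrier_mat d d'"
    by (auto simp: Z0_def Z1_def Q_mat_def H_mat_def)
  moreover have "unimodular_orthogonal_rows m d H"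
    using assms(4) by (simp add: partial_hadamard_def)
  ultimately show ?thesis
    using umeb_state_of_mat_iff[OF assms(1)] unextendible_layer_basis_iff[OF d' assms(4)]
      hadamard_extendible_iff by simp
qed

end
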